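(* The orthogonal polynomial system $Y_n(x;u)$ corresponding to a deformed $\mathbb D$-semi-classical weight satisfies the deformation divided-difference equation $$\mathbb D_uY_n=B_n\,\mathbb M_uY_n,\qquad B_n=\frac1{R_n}\begin{pmatrix}\Gamma_n&\Phi_n\\ \Psi_n&\Xi_n\end{pmatrix},\qquad n\ge0,$$ where $R_n,\Gamma_n,\Xi_n,\Phi_n,\Psi_n$ are the deformation coefficients defined in the context.
   Context: **Lattices.** Let $\iota_\pm(x)$ be the two roots $y$ of a symmetric quadratic $\mathcal Ay^2+2\mathcal Bxy+\mathcal Ax^2+2\mathcal D(x+y)+\mathcal F=0$, $\mathcal A\ne0$; $y_\pm=\iota_\pm(x)$, $\Delta y=y_+-y_-$, $\mathbb D_xh=(h(y_+)-h(y_-))/\Delta y$, $\mathbb M_xh=\frac12(h(y_+)+h(y_-))$. The deformation variable $u$ has its own lattice of this kind (possibly a different conic), with $v_\pm=\iota_\pm(u)$, $\Delta v=v_+-v_-$ and operators $\mathbb D_uh=(h(v_+)-h(v_-))/\Delta v$, $\mathbb M_uh=\frac12(h(v_+)+h(v_-))$. **Weight and OPS.** $w(x;u)$ is a weight on a lattice support $G$ (with $\int_G\mathbb Dx\,h=\sum_s\Delta y(x_s)h(x_s)$). $p_n(x;u)=\gamma_n(u)x^n+\cdots$ are orthonormal, $\int_G\mathbb Dx\,w\,p_mp_n=\delta_{mn}$, $p_{-1}=0$; $F(x;u)=\int_G\mathbb Dy\,\frac{w(y;u)}{x-y}$; $q_n(x;u)=\int_G\mathbb Dy\,w(y;u)\frac{p_n(y;u)}{x-y}$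 for $n\ge0$. $a_{n+1}p_{n+1}=(x-b_n)p_n-a_np_{n-1}$ with $a_n=\gamma_{n-1}/\gamma_n$ ($n\ge1$); $a_0\neq0$ is arbitrary and $q_{-1}=1/(a_0\gamma_0)$. One has $p_nq_{n-1}-p_{n-1}q_n=1/a_n$. Set $Y_n=\begin{pmatrix} p_n & q_n/w \\ p_{n-1} & q_{n-1}/w \end{pmatrix}$. **Deformed $\mathbb D$-semi-classical weight:** $w(y_+;u)/w(y_-;u)=\frac{W+\Delta yV}{W-\Delta yV}(x;u)$ and $R\,\mathbb D_uw=2S\,\mathbb M_uw$, i.e. $w(x;v_+)/w(x;v_-)=\frac{R+\Delta vS}{R-\Delta vS}(x;u)$, with $W,V,R,S$ polynomials in $x$, $W\pm\Delta yV\ne0$ on $G$, $R\pm\Delta vS\neq0$ for $x\in G$, $\gamma_n(v_\pm)\ne0$ for all $n$, and $\gamma_0(v_+)(R-\Delta vS)+\gamma_0(v_-)(R+\Delta vS)\ne0$. **Deformation coefficients.** Write $p_n^\pm=p_n(x;v_\pm)$, $q_n^\pm=q_n(x;v_\pm)$, $a_n^\pm=a_n(v_\pm)$, $R^\pm=R\pm\Delta vS$, and let $H_n(u)\ne0$ be independent of $x$. For $n\ge0$: $\frac2{H_n}R_n=R^+[-\frac1{a_n^-}+p_{n-1}^+q_n^--p_n^+q_{n-1}^-]+R^-[-\frac1{a_n^+}+p_{n-1}^-q_n^+-p_n^-q_{n-1}^+]$, $\frac{\Delta v}{H_n}\Gamma_n=R^+[\frac1{a_n^-}-p_{n-1}^+q_n^--p_n^+q_{n-1}^-]+R^-[-\frac1{a_n^+}+p_{n-1}^-q_n^++p_n^-q_{n-1}^+]$,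 $\frac{\Delta v}{H_n}\Xi_n=R^+[\frac1{a_n^-}+p_{n-1}^+q_n^-+p_n^+q_{n-1}^-]+R^-[-\frac1{a_n^+}-p_{n-1}^-q_n^+-p_n^-q_{n-1}^+]$, $\frac{\Delta v}{2H_n}\Phi_n=R^+p_n^+q_n^--R^-p_n^-q_n^+$, $\frac{\Delta v}{2H_n}\Psi_n=-R^+p_{n-1}^+q_{n-1}^-+R^-p_{n-1}^-q_{n-1}^+$. Identities involving $1/R_n$ are understood where $R_n\neq0$. *)

theory Defs
  imports "HOL-Analysis.Analysis" "HOL-Computational_Algebra.Polynomial"
begin

record lattice =
  coefA :: complex
  coefB :: complex
  coefD :: complex
  coefF :: complex
  iota_plus :: "complex \<Rightarrow> complex"
  iota_minus :: "complex \<Rightarrow> complex"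

text \<open>The factorisation says that iota_plus x and iota_minus x are the two roots y, counted with
  multiplicity. The labelling of the two roots may be chosen freely at each x.\<close>
definition conic_lattice :: "lattice \<Rightarrow> bool" where
  "conic_lattice L \<longleftrightarrow> coefA L \<noteq> 0 \<and>
     (\<forall>x y. coefA L * y^2 + 2 * coefB L * x * y + coefA L * x^2 + 2 * coefD L * (x + y) + coefF L
          = coefA L * (y - iota_plus L x) * (y - iota_minus L x))"

definition gap :: "lattice \<Rightarrow> complex \<Rightarrow> complex" where
  "gap L x = iota_plus L x - iota_minus L x"

definition DD :: "lattice \<Rightarrow> (complex \<Rightarrow> complex) \<Rightarrow> complex \<Rightarrow> complex" where
  "DD L h x = (h (iota_plus L x) - h (iota_minus L x)) / gap L x"

definition MM :: "lattice \<Rightarrow> (complex \<Rightarrow> complex) \<Rightarrow> complex \<Rightarrow> complex" where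
  "MM L h x = (h (iota_plus L x) + h (iota_minus L x)) / 2"

definition DD_mat :: "lattice \<Rightarrow> (complex \<Rightarrow> complex^2^2) \<Rightarrow> complex \<Rightarrow> complex^2^2" where
  "DD_mat L Y u = (\<chi> i j. DD L (\<lambda>t. Y t $ i $ j) u)"

definition MM_mat :: "lattice \<Rightarrow> (complex \<Rightarrow> complex^2^2) \<Rightarrow> complex \<Rightarrow> complex^2^2" where
  "MM_mat L Y u = (\<chi> i j. MM L (\<lambda>t. Y t $ i $ j) u)"

text \<open>The data of a weight w(x;t) together with its orthonormal polynomials. The deformation variable
  u runs over ulocs; the weight and the polynomials are evaluated at parameters t in params, which
  contains the neighbours of every u in ulocs. The set xdom is the domain in x of the weight,
  regarded as a function on and off the support.\<close>
record deformed_data =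
  xlat :: lattice
  ulat :: lattice
  pts :: "int \<Rightarrow> complex"
  idx :: "int set"
  xdom :: "complex set"
  params :: "complex set"
  ulocs :: "complex set"
  wt :: "complex \<Rightarrow> complex \<Rightarrow> complex"            \<comment> \<open>arguments x, t\<close>
  opoly :: "nat \<Rightarrow> complex \<Rightarrow> complex poly"          \<comment> \<open>arguments n, t\<close>
  azero :: "complex \<Rightarrow> complex"
  polyW :: "complex \<Rightarrow> complex poly"                 \<comment> \<open>argument t\<close>
  polyV :: "complex \<Rightarrow> complex poly"
  polyR :: "complex \<Rightarrow> complex poly"                 \<comment> \<open>argument u\<close>
  polyS :: "complex \<Rightarrow> complex poly"
  normH :: "nat \<Rightarrow> complex \<Rightarrow> complex"               \<comment> \<open>arguments n, u\<close>

abbreviation vplus :: "deformed_data \<Rightarrow> complex \<Rightarrow> complex" where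
  "vplus Z u \<equiv> iota_plus (ulat Z) u"

abbreviation vminus :: "deformed_data \<Rightarrow> complex \<Rightarrow> complex" where
  "vminus Z u \<equiv> iota_minus (ulat Z) u"

abbreviation Delta_v :: "deformed_data \<Rightarrow> complex \<Rightarrow> complex" where
  "Delta_v Z u \<equiv> gap (ulat Z) u"

definition support :: "deformed_data \<Rightarrow> complex set" where
  "support Z = pts Z ` idx Z"

text \<open>Two consecutive points of the lattice have a common neighbour on the dual lattice.\<close>
definition lattice_support :: "deformed_data \<Rightarrow> bool" where
  "lattice_support Z \<longleftrightarrow>
     (\<forall>s. s \<in> idx Z \<longrightarrow> s + 1 \<in> idx Z \<longrightarrow>
        iota_plus (xlat Z) (pts Z s) = iota_minus (xlat Z) (pts Z (s + 1))) \<and>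
     support Z \<subseteq> xdom Z"

definition D_integral :: "deformed_data \<Rightarrow> (complex \<Rightarrow> complex) \<Rightarrow> complex" where
  "D_integral Z h = (\<Sum>\<^sub>\<infinity>s\<in>idx Z. gap (xlat Z) (pts Z s) * h (pts Z s))"

definition D_integrable :: "deformed_data \<Rightarrow> (complex \<Rightarrow> complex) \<Rightarrow> bool" where
  "D_integrable Z h \<longleftrightarrow> (\<lambda>s. gap (xlat Z) (pts Z s) * h (pts Z s)) summable_on idx Z"

definition lead :: "deformed_data \<Rightarrow> nat \<Rightarrow> complex \<Rightarrow> complex" where
  "lead Z n t = coeff (opoly Z n t) n"

text \<open>Orthonormality is bilinear: there is no complex conjugation.\<close>
definition orthonormal_system :: "deformed_data \<Rightarrow> bool" where
  "orthonormal_system Z \<longleftrightarrow> (\<forall>t\<in>params Z.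
     (\<forall>k. D_integrable Z (\<lambda>y. wt Z y t * y ^ k)) \<and>
     (\<forall>n. degree (opoly Z n t) \<le> n) \<and>
     (\<forall>m n. D_integral Z (\<lambda>y. wt Z y t * poly (opoly Z m t) y * poly (opoly Z n t) y)
          = (if m = n then 1 else 0)) \<and>
     azero Z t \<noteq> 0)"

definition acoef :: "deformed_data \<Rightarrow> nat \<Rightarrow> complex \<Rightarrow> complex" where
  "acoef Z n t = (if n = 0 then azero Z t else lead Z (n - 1) t / lead Z n t)"

definition pfun :: "deformed_data \<Rightarrow> nat \<Rightarrow> complex \<Rightarrow> complex \<Rightarrow> complex" where
  "pfun Z n x t = poly (opoly Z n t) x"

definition qfun :: "deformed_data \<Rightarrow> nat \<Rightarrow> complex \<Rightarrow> complex \<Rightarrow> complex" where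
  "qfun Z n x t = D_integral Z (\<lambda>y. wt Z y t * (poly (opoly Z n t) y / (x - y)))"

text \<open>The functions with index n - 1, including the conventions for the index -1.\<close>
definition pprev :: "deformed_data \<Rightarrow> nat \<Rightarrow> complex \<Rightarrow> complex \<Rightarrow> complex" where
  "pprev Z n x t = (if n = 0 then 0 else pfun Z (n - 1) x t)"

definition qprev :: "deformed_data \<Rightarrow> nat \<Rightarrow> complex \<Rightarrow> complex \<Rightarrow> complex" where
  "qprev Z n x t = (if n = 0 then 1 / (azero Z t * lead Z 0 t) else qfun Z (n - 1) x t)"

definition Ymat :: "deformed_data \<Rightarrow> nat \<Rightarrow> complex \<Rightarrow> complex \<Rightarrow> complex^2^2" where
  "Ymat Z n x t = vector [vector [pfun Z n x t, qfun Z n x t / wt Z x t],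
                          vector [pprev Z n x t, qprev Z n x t / wt Z x t]]"

text \<open>The points x off the support at which the sum F(x;t) converges. At a support point the term
  with x = y would be an instance of division by zero.\<close>
definition stieltjes_dom :: "deformed_data \<Rightarrow> complex \<Rightarrow> complex set" where
  "stieltjes_dom Z t = {x. x \<notin> support Z \<and> D_integrable Z (\<lambda>y. wt Z y t / (x - y))}"

text \<open>The ratio condition w(y+)/w(y-) = (W + dy V)/(W - dy V) cleared of denominators,
  as these are only known to be nonzero on the support.\<close>
definition semi_classical :: "deformed_data \<Rightarrow> bool" where
  "semi_classical Z \<longleftrightarrow> (\<forall>t\<in>params Z.
     (\<forall>x. iota_plus (xlat Z) x \<in> xdom Z \<longrightarrow> iota_minus (xlat Z) x \<in> xdom Z \<longrightarrow>
        wt Z (iota_plus (xlat Z) x) t * (poly (polyW Z t) x - gap (xlat Z) x * poly (polyV Z t) x)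
      = wt Z (iota_minus (xlat Z) x) t * (poly (polyW Z t) x + gap (xlat Z) x * poly (polyV Z t) x)) \<and>
     (\<forall>x\<in>support Z.
        poly (polyW Z t) x + gap (xlat Z) x * poly (polyV Z t) x \<noteq> 0 \<and>
        poly (polyW Z t) x - gap (xlat Z) x * poly (polyV Z t) x \<noteq> 0))"

definition Rplus :: "deformed_data \<Rightarrow> complex \<Rightarrow> complex poly" where
  "Rplus Z u = polyR Z u + smult (Delta_v Z u) (polyS Z u)"

definition Rminus :: "deformed_data \<Rightarrow> complex \<Rightarrow> complex poly" where
  "Rminus Z u = polyR Z u - smult (Delta_v Z u) (polyS Z u)"

text \<open>The last condition is read as non-vanishing of a polynomial in x.\<close>
definition deformed :: "deformed_data \<Rightarrow> bool" where
  "deformed Z \<longleftrightarrow> (\<forall>u\<in>ulocs Z.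
     vplus Z u \<in> params Z \<and> vminus Z u \<in> params Z \<and> Delta_v Z u \<noteq> 0 \<and>
     (\<forall>x\<in>xdom Z. poly (polyR Z u) x * DD (ulat Z) (\<lambda>t. wt Z x t) u
                = 2 * poly (polyS Z u) x * MM (ulat Z) (\<lambda>t. wt Z x t) u) \<and>
     (\<forall>x\<in>support Z. poly (Rplus Z u) x \<noteq> 0 \<and> poly (Rminus Z u) x \<noteq> 0) \<and>
     (\<forall>n. lead Z n (vplus Z u) \<noteq> 0 \<and> lead Z n (vminus Z u) \<noteq> 0) \<and>
     smult (lead Z 0 (vplus Z u)) (Rminus Z u) + smult (lead Z 0 (vminus Z u)) (Rplus Z u) \<noteq> 0)"

definition Rn :: "deformed_data \<Rightarrow> nat \<Rightarrow> complex \<Rightarrow> complex \<Rightarrow> complex" where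
  "Rn Z n x u = (let vp = vplus Z u; vm = vminus Z u in normH Z n u / 2 *
     (poly (Rplus Z u) x * (- 1 / acoef Z n vm + pprev Z n x vp * qfun Z n x vm - pfun Z n x vp * qprev Z n x vm)
    + poly (Rminus Z u) x * (- 1 / acoef Z n vp + pprev Z n x vm * qfun Z n x vp - pfun Z n x vm * qprev Z n x vp)))"

definition Gamman :: "deformed_data \<Rightarrow> nat \<Rightarrow> complex \<Rightarrow> complex \<Rightarrow> complex" where
  "Gamman Z n x u = (let vp = vplus Z u; vm = vminus Z u in normH Z n u / Delta_v Z u *
     (poly (Rplus Z u) x * (1 / acoef Z n vm - pprev Z n x vp * qfun Z n x vm - pfun Z n x vp * qprev Z n x vm)
    + poly (Rminus Z u) x * (- 1 / acoef Z n vp + pprev Z n x vm * qfun Z n x vp + pfun Z n x vm * qprev Z n x vp)))"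

definition Xin :: "deformed_data \<Rightarrow> nat \<Rightarrow> complex \<Rightarrow> complex \<Rightarrow> complex" where
  "Xin Z n x u = (let vp = vplus Z u; vm = vminus Z u in normH Z n u / Delta_v Z u *
     (poly (Rplus Z u) x * (1 / acoef Z n vm + pprev Z n x vp * qfun Z n x vm + pfun Z n x vp * qprev Z n x vm)
    + poly (Rminus Z u) x * (- 1 / acoef Z n vp - pprev Z n x vm * qfun Z n x vp - pfun Z n x vm * qprev Z n x vp)))"

definition Phin :: "deformed_data \<Rightarrow> nat \<Rightarrow> complex \<Rightarrow> complex \<Rightarrow> complex" where
  "Phin Z n x u = (let vp = vplus Z u; vm = vminus Z u in 2 * normH Z n u / Delta_v Z u *
     (poly (Rplus Z u) x * pfun Z n x vp * qfun Z n x vm - poly (Rminus Z u) x * pfun Z n x vm * qfun Z n x vp))"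

definition Psin :: "deformed_data \<Rightarrow> nat \<Rightarrow> complex \<Rightarrow> complex \<Rightarrow> complex" where
  "Psin Z n x u = (let vp = vplus Z u; vm = vminus Z u in 2 * normH Z n u / Delta_v Z u *
     (- poly (Rplus Z u) x * pprev Z n x vp * qprev Z n x vm + poly (Rminus Z u) x * pprev Z n x vm * qprev Z n x vp))"

definition Bmat :: "deformed_data \<Rightarrow> nat \<Rightarrow> complex \<Rightarrow> complex \<Rightarrow> complex^2^2" where
  "Bmat Z n x u = (\<chi> i j. 1 / Rn Z n x u *
     (vector [vector [Gamman Z n x u, Phin Z n x u],
              vector [Psin Z n x u, Xin Z n x u]] :: complex^2^2) $ i $ j)"

end

theory Submission
  imports Defs
begin

text \<open>The Casoratian identity p_n q_{n-1} - p_{n-1} q_n = 1/a_n comes from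
  orthogonality: writing p_n(y) = p_n(x) + (y - x) P_n(y), the left-hand side is the integral of
  w (P_n p_{n-1} - P_{n-1} p_n), in which only the leading coefficient of P_n survives.
  Evaluated at both deformation parameters, and with R_+ w_- = R_- w_+, it turns
  the four entries of the claim into rational identities.\<close>

text \<open>The moment functional of the weight at \<open>t\<close>. Restricting it to polynomials
  lets finiteness of the moments supply every summability condition.\<close>

definition L_int :: "deformed_data \<Rightarrow> complex \<Rightarrow> complex poly \<Rightarrow> complex" where
  "L_int Z t f = D_integral Z (\<lambda>y. wt Z y t * poly f y)"

lemma D_integrable_add:
  "D_integrable Z f \<Longrightarrow> D_integrable Z g \<Longrightarrow> D_integrable Z (\<lambda>y. f y + g y)"
  unfolding D_integrable_def by (simp add: distrib_left summable_on_add)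

lemma D_integrable_cmult: "D_integrable Z f \<Longrightarrow> D_integrable Z (\<lambda>y. c * f y)"
  unfolding D_integrable_def
  by (drule summable_on_cmult_right[where c = c]) (simp add: mult.left_commute)

lemma D_integral_add:
  "D_integrable Z f \<Longrightarrow> D_integrable Z g \<Longrightarrow>
    D_integral Z (\<lambda>y. f y + g y) = D_integral Z f + D_integral Z g"
  unfolding D_integrable_def D_integral_def by (simp add: distrib_left infsum_add)

text \<open>No summability is assumed: for \<open>c \<noteq> 0\<close> both sums converge or both
  take the default value 0.\<close>

lemma D_integral_cmult: "D_integral Z (\<lambda>y. c * f y) = c * D_integral Z f"
  unfolding D_integral_def by (simp add: mult.left_commute infsum_cmult_right')

lemma D_integral_cong:
  "(\<And>y. y \<in> support Z \<Longrightarrow> f y = g y) \<Longrightarrow> D_integral Z f = D_integral Z g"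
  unfolding D_integral_def support_def by (intro infsum_cong) auto

lemma D_integrable_poly:
  assumes "orthonormal_system Z" "t \<in> params Z"
  shows "D_integrable Z (\<lambda>y. wt Z y t * poly f y)"
proof -
  have moments: "D_integrable Z (\<lambda>y. wt Z y t * y ^ k)" for k
    using assms unfolding orthonormal_system_def by blast
  \<comment> \<open>The extra factor \<open>y ^ k\<close> strengthens the induction: passing from
    \<open>f\<close> to \<open>pCons a f\<close> moves one power of \<open>y\<close> into
    it.\<close>
  have "D_integrable Z (\<lambda>y. wt Z y t * (y ^ k * poly f y))" for k
  proof (induction f arbitrary: k)
    case 0
    show ?case by (simp add: D_integrable_def)
  next
    case (pCons a f)
    have "D_integrable Z (\<lambda>y. a * (wt Z y t * y ^ k) + wt Z y t * (y ^ Suc k * poly f y))"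
      using pCons.IH moments by (intro D_integrable_add D_integrable_cmult)
    then show ?case by (simp add: algebra_simps)
  qed
  from this[of 0] show ?thesis by simp
qed

lemma L_int_add:
  assumes "orthonormal_system Z" "t \<in> params Z"
  shows "L_int Z t (f + g) = L_int Z t f + L_int Z t g"
  using D_integral_add[OF D_integrable_poly[OF assms] D_integrable_poly[OF assms]]
  by (simp add: L_int_def distrib_left)

lemma L_int_smult: "L_int Z t (smult c f) = c * L_int Z t f"
  using D_integral_cmult[of Z c "\<lambda>y. wt Z y t * poly f y"]
  by (simp add: L_int_def mult.left_commute)

lemma L_int_diff:
  assumes "orthonormal_system Z" "t \<in> params Z"
  shows "L_int Z t (f - g) = L_int Z t f - L_int Z t g"
  using L_int_add[OF assms, of "f - g" g] by simp

lemma L_int_opoly: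
  assumes "orthonormal_system Z" "t \<in> params Z"
  shows "L_int Z t (opoly Z m t * opoly Z n t) = (if m = n then 1 else 0)"
  using assms unfolding orthonormal_system_def L_int_def by (simp add: mult.assoc)

text \<open>Expansion of \<open>f\<close> in the orthonormal polynomials, one top term at a time.
  The bound \<open>m\<close> need not be the exact degree, so the remainder after each subtraction
  is again covered.\<close>

lemma L_int_mult_opoly:
  assumes os: "orthonormal_system Z" "t \<in> params Z" and lead: "\<And>k. lead Z k t \<noteq> 0"
    and "\<And>i. i > m \<Longrightarrow> coeff f i = 0" "m \<le> n"
  shows "L_int Z t (f * opoly Z n t) = (if m = n then coeff f n / lead Z n t else 0)"
  using assms(4,5)
proof (induction m arbitrary: f)
  case 0
  have "degree (opoly Z 0 t) = 0"
    using os unfolding orthonormal_system_def by (metis le_zero_eq)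
  then have f: "f = smult (coeff f 0 / lead Z 0 t) (opoly Z 0 t)"
  proof (intro poly_eqI)
    fix i
    show "coeff f i = coeff (smult (coeff f 0 / lead Z 0 t) (opoly Z 0 t)) i"
      using 0 lead[of 0] \<open>degree (opoly Z 0 t) = 0\<close>
      by (cases "i = 0") (auto simp: lead_def coeff_eq_0)
  qed
  have "L_int Z t (f * opoly Z n t) =
      coeff f 0 / lead Z 0 t * L_int Z t (opoly Z 0 t * opoly Z n t)"
    by (subst f) (simp add: L_int_smult)
  then show ?case using L_int_opoly[OF os] by simp
next
  case (Suc m)
  define c where "c = coeff f (Suc m) / lead Z (Suc m) t"
  define g where "g = f - smult c (opoly Z (Suc m) t)"
  have deg: "degree (opoly Z (Suc m) t) \<le> Suc m"
    using os unfolding orthonormal_system_def by blast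
  have "coeff g i = 0" if "i > m" for i
  proof (cases "i = Suc m")
    case True
    then show ?thesis using lead[of "Suc m"] by (simp add: g_def c_def lead_def)
  next
    case False
    then have "i > Suc m" using that by simp
    moreover from this have "coeff (opoly Z (Suc m) t) i = 0"
      using deg by (intro coeff_eq_0) simp
    ultimately show ?thesis using Suc.prems by (simp add: g_def)
  qed
  \<comment> \<open>As \<open>Suc m \<le> n\<close>, the bound \<open>m\<close> for \<open>g\<close>
    is strictly below \<open>n\<close>, so the induction hypothesis yields 0 and only the subtracted
    multiple can contribute.\<close>
  then have "L_int Z t (g * opoly Z n t) = 0" using Suc.IH[of g] Suc.prems by simp
  moreover have "f * opoly Z n t = g * opoly Z n t + smult c (opoly Z (Suc m) t * opoly Z n t)"
    by (simp add: g_def algebra_simps)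
  ultimately show ?case
    using L_int_add[OF os] L_int_smult L_int_opoly[OF os] by (simp add: c_def)
qed

text \<open>The difference quotient of \<open>p\<close> at \<open>x\<close> is a polynomial in
  \<open>y\<close>; it will cancel the pole of the kernel 1/(x - y).\<close>

lemma poly_eq_synthetic_div:
  "poly p (y :: 'a :: comm_ring_1) = poly p x + (y - x) * poly (synthetic_div p x) y"
  using arg_cong[OF synthetic_div_correct'[of x p], of "\<lambda>f. poly f y"]
  by (simp add: algebra_simps)

lemma coeff_synthetic_div_eq_0:
  "degree p \<le> n \<Longrightarrow> i \<ge> n \<Longrightarrow> i > 0 \<Longrightarrow> coeff (synthetic_div p x) i = 0"
  by (cases "degree p = 0")
    (auto intro!: coeff_eq_0 simp: degree_synthetic_div synthetic_div_eq_0_iff)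

text \<open>Splitting p_n(y) at \<open>x\<close> under the integral gives q_n = p_n F minus the
  associated polynomial. Membership in \<open>stieltjes_dom\<close> keeps x - y nonzero on the
  support and makes the sum for F converge, so the integral may be split.\<close>

lemma qfun_eq:
  assumes os: "orthonormal_system Z" "t \<in> params Z" and x: "x \<in> stieltjes_dom Z t"
  shows "qfun Z n x t = pfun Z n x t * D_integral Z (\<lambda>y. wt Z y t / (x - y))
    - L_int Z t (synthetic_div (opoly Z n t) x)"
proof -
  let ?P = "synthetic_div (opoly Z n t) x"
  have "wt Z y t * (poly (opoly Z n t) y / (x - y)) =
      pfun Z n x t * (wt Z y t / (x - y)) + (- 1) * (wt Z y t * poly ?P y)"
    if "y \<in> support Z" for y
  proof -
    have "x - y \<noteq> 0" using that x by (auto simp: stieltjes_dom_def)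
    then show ?thesis
      unfolding pfun_def poly_eq_synthetic_div[of "opoly Z n t" y x]
      by (simp add: field_simps)
  qed
  then have "qfun Z n x t = D_integral Z
      (\<lambda>y. pfun Z n x t * (wt Z y t / (x - y)) + (- 1) * (wt Z y t * poly ?P y))"
    unfolding qfun_def by (rule D_integral_cong)
  also have "\<dots> = D_integral Z (\<lambda>y. pfun Z n x t * (wt Z y t / (x - y)))
      + D_integral Z (\<lambda>y. (- 1) * (wt Z y t * poly ?P y))"
    using x D_integrable_poly[OF os]
    by (intro D_integral_add D_integrable_cmult) (auto simp: stieltjes_dom_def)
  finally show ?thesis unfolding D_integral_cmult by (simp add: L_int_def)
qed

text \<open>By \<open>qfun_eq\<close> the terms with F cancel, leaving only integrals of
  polynomials. Index 0 follows directly from the conventions for index -1, since p_0 is the constant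
  \<open>lead Z 0 t\<close>.\<close>

lemma casoratian:
  assumes os: "orthonormal_system Z" "t \<in> params Z" and lead: "\<And>k. lead Z k t \<noteq> 0"
    and x: "x \<in> stieltjes_dom Z t"
  shows "pfun Z n x t * qprev Z n x t - pprev Z n x t * qfun Z n x t = 1 / acoef Z n t"
proof (cases n)
  case 0
  have "degree (opoly Z 0 t) = 0"
    using os unfolding orthonormal_system_def by (metis le_zero_eq)
  then obtain c where "opoly Z 0 t = [:c:]" by (auto elim: degree_eq_zeroE)
  then show ?thesis using 0 lead[of 0]
    by (simp add: lead_def pfun_def qprev_def pprev_def acoef_def)
next
  case (Suc m)
  let ?p = "\<lambda>k. opoly Z k t"
  let ?P = "\<lambda>k. synthetic_div (opoly Z k t) x"
  have deg: "degree (?p k) \<le> k" for k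
    using os unfolding orthonormal_system_def by blast
  \<comment> \<open>Trades the values p_m(x), p_n(x) for the polynomials in \<open>y\<close>; the
    two correction terms (y - x) P_m P_n cancel.\<close>
  have exchange: "smult (poly (?p m) x) (?P n) - smult (poly (?p n) x) (?P m)
      = ?P n * ?p m - ?P m * ?p n"
  proof (rule poly_eq_poly_eq_iff[THEN iffD1], rule ext)
    fix y
    show "poly (smult (poly (?p m) x) (?P n) - smult (poly (?p n) x) (?P m)) y
        = poly (?P n * ?p m - ?P m * ?p n) y"
      using poly_eq_synthetic_div[of "?p m" y x] poly_eq_synthetic_div[of "?p n" y x]
      unfolding poly_diff poly_smult poly_mult by algebra
  qed
  have "pfun Z n x t * qprev Z n x t - pprev Z n x t * qfun Z n x t
      = poly (?p m) x * L_int Z t (?P n) - poly (?p n) x * L_int Z t (?P m)"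
    using Suc by (simp add: qprev_def pprev_def qfun_eq[OF os x] pfun_def algebra_simps)
  also have "\<dots> = L_int Z t (?P n * ?p m) - L_int Z t (?P m * ?p n)"
    by (metis L_int_diff[OF os] L_int_smult exchange)
  also have "L_int Z t (?P m * ?p n) = 0"
    using L_int_mult_opoly[OF os lead, of m "?P m" n] Suc coeff_synthetic_div_eq_0[OF deg]
    by simp
  \<comment> \<open>P_n has degree at most n - 1 = m, so pairing with p_m extracts its coefficient
    at \<open>m\<close>.\<close>
  also have "L_int Z t (?P n * ?p m) = coeff (?P n) m / lead Z m t"
    using L_int_mult_opoly[OF os lead, of m "?P n" m] Suc coeff_synthetic_div_eq_0[OF deg]
    by simp
  \<comment> \<open>Comparison of coefficients at \<open>n\<close> in (y - x) P_n + p_n(x) = p_n: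
    the constant p_n(x) does not reach this index because \<open>n = Suc m\<close>.\<close>
  also have "coeff (?P n) m = lead Z n t"
    using arg_cong[OF synthetic_div_correct'[of x "?p n"], of "\<lambda>f. coeff f n"]
      coeff_synthetic_div_eq_0[OF deg, of n n] Suc
    by (simp add: lead_def)
  finally show ?thesis using Suc by (simp add: acoef_def)
qed

text \<open>Multiplying the deformation equation by \<open>Delta_v Z u\<close> and regrouping by
  weight gives this. The product form stays meaningful where \<open>Rplus\<close> or
  \<open>Rminus\<close> vanishes off the support.\<close>

lemma weight_ratio:
  assumes "deformed Z" "u \<in> ulocs Z" "x \<in> xdom Z"
  shows "poly (Rminus Z u) x * wt Z x (vplus Z u) = poly (Rplus Z u) x * wt Z x (vminus Z u)"
proof -
  have "Delta_v Z u \<noteq> 0" and "poly (polyR Z u) x * DD (ulat Z) (\<lambda>t. wt Z x t) u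
      = 2 * poly (polyS Z u) x * MM (ulat Z) (\<lambda>t. wt Z x t) u"
    using assms unfolding deformed_def by blast+
  then have "poly (polyR Z u) x * (wt Z x (vplus Z u) - wt Z x (vminus Z u)) =
      Delta_v Z u * poly (polyS Z u) x * (wt Z x (vplus Z u) + wt Z x (vminus Z u))"
    by (simp add: DD_def MM_def divide_eq_eq mult_ac)
  then show ?thesis by (simp add: Rplus_def Rminus_def algebra_simps)
qed

text \<open>Here p, q have index n and r, s index n - 1; primes mark the values at v_-. Every 1/a_n has been
  replaced by its Casoratian, which makes the identities hold term by term.\<close>
lemma deformation_entries:
  fixes A B D H R G X F S p p' r r' q q' s s' w w' :: complex
  assumes R_def: "R = H / 2 * (A * (- (p' * s' - r' * q') + r * q' - p * s')
                       + B * (- (p * s - r * q) + r' * q - p' * s))"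
    and G_def: "G = H / D * (A * ((p' * s' - r' * q') - r * q' - p * s')
                     + B * (- (p * s - r * q) + r' * q + p' * s))"
    and X_def: "X = H / D * (A * ((p' * s' - r' * q') + r * q' + p * s')
                     + B * (- (p * s - r * q) - r' * q - p' * s))"
    and F_def: "F = 2 * H / D * (A * p * q' - B * p' * q)"
    and S_def: "S = 2 * H / D * (- A * r * s' + B * r' * s)"
    and D: "D \<noteq> 0" and w: "w \<noteq> 0" "w' \<noteq> 0" and ratio: "B * w = A * w'" and R: "R \<noteq> 0"
  shows "(p - p') / D = 1 / R * G * ((p + p') / 2) + 1 / R * F * ((r + r') / 2)"
    and "(r - r') / D = 1 / R * S * ((p + p') / 2) + 1 / R * X * ((r + r') / 2)"
    and "(q / w - q' / w') / D =
      1 / R * G * ((q / w + q' / w') / 2) + 1 / R * F * ((s / w + s' / w') / 2)"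
    and "(s / w - s' / w') / D =
      1 / R * S * ((q / w + q' / w') / 2) + 1 / R * X * ((s / w + s' / w') / 2)"
proof -
  \<comment> \<open>The weight relation says A/w = B/w' = \<open>k\<close>. Expressing
    \<open>A\<close> and \<open>B\<close> through \<open>k\<close> cancels the weights that divide
    the second column of the matrix.\<close>
  define k where "k = A / w"
  have A: "A = k * w" using w by (simp add: k_def)
  have B: "B = k * w'" using ratio w by (simp add: k_def field_simps)
  have entry: "y = 1 / R * g * a + 1 / R * f * b" if "R * y = g * a + f * b" for y g a f b
    using that R by (simp add: field_simps)
  show "(p - p') / D = 1 / R * G * ((p + p') / 2) + 1 / R * F * ((r + r') / 2)"
    by (rule entry) (use D in \<open>simp add: R_def G_def F_def field_simps\<close>)
  show "(r - r') / D = 1 / R * S * ((p + p') / 2) + 1 / R * X * ((r + r') / 2)"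
    by (rule entry) (use D in \<open>simp add: R_def S_def X_def field_simps\<close>)
  show "(q / w - q' / w') / D =
      1 / R * G * ((q / w + q' / w') / 2) + 1 / R * F * ((s / w + s' / w') / 2)"
    by (rule entry) (use D w in \<open>simp add: R_def G_def F_def A B field_simps\<close>)
  show "(s / w - s' / w') / D =
      1 / R * S * ((q / w + q' / w') / 2) + 1 / R * X * ((s / w + s' / w') / 2)"
    by (rule entry) (use D w in \<open>simp add: R_def S_def X_def A B field_simps\<close>)
qed

theorem proposition6p6:
  fixes Z :: deformed_data and n :: nat and u x :: complex
  assumes "conic_lattice (xlat Z)"
    and "conic_lattice (ulat Z)"
    and "lattice_support Z"
    and "orthonormal_system Z"
    and "semi_classical Z"
    and "deformed Z"
    and "\<And>k u. u \<in> ulocs Z \<Longrightarrow> normH Z k u \<noteq> 0"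
    and "u \<in> ulocs Z"
    and "x \<in> xdom Z"
    and "x \<in> stieltjes_dom Z (vplus Z u)"
    and "x \<in> stieltjes_dom Z (vminus Z u)"
    and "wt Z x (vplus Z u) \<noteq> 0"
    and "wt Z x (vminus Z u) \<noteq> 0"
    and "Rn Z n x u \<noteq> 0"
  shows "DD_mat (ulat Z) (\<lambda>t. Ymat Z n x t) u
       = Bmat Z n x u ** MM_mat (ulat Z) (\<lambda>t. Ymat Z n x t) u"
proof -
  let ?vp = "vplus Z u" and ?vm = "vminus Z u"
  have par: "?vp \<in> params Z" "?vm \<in> params Z" and D: "Delta_v Z u \<noteq> 0"
    and lead: "\<And>k. lead Z k ?vp \<noteq> 0" "\<And>k. lead Z k ?vm \<noteq> 0"
    using \<open>deformed Z\<close> \<open>u \<in> ulocs Z\<close> unfolding deformed_def by blast+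
  note os = \<open>orthonormal_system Z\<close>
  note cas = casoratian[OF os par(1) lead(1) \<open>x \<in> stieltjes_dom Z ?vp\<close>, of n, symmetric]
    casoratian[OF os par(2) lead(2) \<open>x \<in> stieltjes_dom Z ?vm\<close>, of n, symmetric]
  \<comment> \<open>The coefficients contain (-1)/a_n; this exposes 1/a_n, which the reversed
    Casoratians at v+ and v- then replace.\<close>
  have minus: "- 1 / a = - (1 / a)" for a :: complex by simp
  note entries = deformation_entries[OF Rn_def[of Z n x u, unfolded Let_def minus cas]
      Gamman_def[of Z n x u, unfolded Let_def minus cas]
      Xin_def[of Z n x u, unfolded Let_def minus cas]
      Phin_def[of Z n x u, unfolded Let_def] Psin_def[of Z n x u, unfolded Let_def]
      D \<open>wt Z x ?vp \<noteq> 0\<close> \<open>wt Z x ?vm \<noteq> 0\<close>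
      weight_ratio[OF \<open>deformed Z\<close> \<open>u \<in> ulocs Z\<close> \<open>x \<in> xdom Z\<close>] \<open>Rn Z n x u \<noteq> 0\<close>]
  show ?thesis
    unfolding vec_eq_iff forall_2 matrix_matrix_mult_def
    using entries
    by (simp add: sum_2 DD_mat_def MM_mat_def DD_def MM_def Ymat_def Bmat_def)
qed

end
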